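(* Let $\alpha>0$, $S_0>0$, and let $H\in C_y^3C_s^1(\mathbb R^{3+1})$, $H:\mathbb R^3\times\mathbb R\to\mathbb R^3$, be a time periodic solution with period $S_0$ (i.e. $H(y,s+S_0)=H(y,s)$ for all $(y,s)$) of $$\partial_s H+\frac{\alpha}{\alpha+2}H+\frac{1}{\alpha+2}(y\cdot\nabla)H+\nabla\times((\nabla\times H)\times H)=0,\qquad \nabla\cdot H=0\qquad\text{on }\mathbb R^3\times\mathbb R.$$ Let $J=(J_1,J_2,J_3)=\nabla\times H$. Assume that for all $s\in(0,S_0)$, the point $y=0$ is a local extremal point (local maximum or local minimum) of $J_i(\cdot,s)$ for all $i=1,2,3$, and $J(0,s)=0$. Then $H\equiv0$ on $\mathbb R^{3+1}$.
   Context: All spatial differential operators ($\nabla$, $\nabla\times$, $\nabla\cdot$) act in the variable $y\in\mathbb R^3$. $\mathbb R^{3+1}=\mathbb R^3\times\mathbb R$ with points $(y,s)$. $C_y^3C_s^1(\mathbb R^{3+1})$ denotes (vector-valued) functions that are $C^3$ in $y$ and $C^1$ in $s$. *)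

theory Defs
  imports "HOL-Analysis.Analysis"
begin

definition pderiv_y :: "3 \<Rightarrow> (real^3 \<Rightarrow> 'b::real_normed_vector) \<Rightarrow> real^3 \<Rightarrow> 'b" where
  "pderiv_y i f y = frechet_derivative f (at y) (axis i 1)"

definition pderiv_s :: "(real^3 \<Rightarrow> real \<Rightarrow> 'b::real_normed_vector) \<Rightarrow> real^3 \<Rightarrow> real \<Rightarrow> 'b" where
  "pderiv_s f y s = vector_derivative (\<lambda>t. f y t) (at s)"

definition divergence :: "(real^3 \<Rightarrow> real^3) \<Rightarrow> real^3 \<Rightarrow> real" where
  "divergence F y = (\<Sum>i\<in>UNIV. pderiv_y i F y $ i)"

definition curl :: "(real^3 \<Rightarrow> real^3) \<Rightarrow> real^3 \<Rightarrow> real^3" where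
  "curl F y = vector
     [pderiv_y 2 F y $ 3 - pderiv_y 3 F y $ 2,
      pderiv_y 3 F y $ 1 - pderiv_y 1 F y $ 3,
      pderiv_y 1 F y $ 2 - pderiv_y 2 F y $ 1]"

text \<open>The operator \<open>(v \<cdot> \<nabla>) F\<close> at the point \<open>y\<close>.\<close>

definition advect :: "real^3 \<Rightarrow> (real^3 \<Rightarrow> 'b::real_normed_vector) \<Rightarrow> real^3 \<Rightarrow> 'b" where
  "advect v F y = (\<Sum>i\<in>UNIV. v $ i *\<^sub>R pderiv_y i F y)"

text \<open>The class of functions that are \<open>C^k\<close> in \<open>y\<close> and \<open>C^1\<close> in \<open>s\<close>: all \<open>y\<close>-derivatives
  up to order \<open>k\<close> and the first \<open>s\<close>-derivative exist and are jointly continuous in \<open>(y, s)\<close>.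
  No condition is put on mixed derivatives in \<open>y\<close> and \<open>s\<close>.\<close>

fun Ck_y :: "nat \<Rightarrow> (real^3 \<Rightarrow> real \<Rightarrow> 'b::real_normed_vector) \<Rightarrow> bool" where
  "Ck_y 0 f \<longleftrightarrow> continuous_on UNIV (\<lambda>(y, s). f y s)"
| "Ck_y (Suc k) f \<longleftrightarrow>
     continuous_on UNIV (\<lambda>(y, s). f y s) \<and>
     (\<forall>y s. (\<lambda>z. f z s) differentiable (at y)) \<and>
     (\<forall>i. Ck_y k (\<lambda>y s. pderiv_y i (\<lambda>z. f z s) y))"

definition C1_s :: "(real^3 \<Rightarrow> real \<Rightarrow> 'b::real_normed_vector) \<Rightarrow> bool" where
  "C1_s f \<longleftrightarrow>
     continuous_on UNIV (\<lambda>(y, s). f y s) \<and>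
     (\<forall>y s. (\<lambda>t. f y t) differentiable (at s)) \<and>
     continuous_on UNIV (\<lambda>(y, s). pderiv_s f y s)"

definition Ck_y_C1_s :: "nat \<Rightarrow> (real^3 \<Rightarrow> real \<Rightarrow> 'b::real_normed_vector) \<Rightarrow> bool" where
  "Ck_y_C1_s k f \<longleftrightarrow> Ck_y k f \<and> C1_s f"

definition local_max_point :: "('a::topological_space \<Rightarrow> real) \<Rightarrow> 'a \<Rightarrow> bool" where
  "local_max_point f x \<longleftrightarrow> (\<forall>\<^sub>F z in nhds x. f z \<le> f x)"

definition local_min_point :: "('a::topological_space \<Rightarrow> real) \<Rightarrow> 'a \<Rightarrow> bool" where
  "local_min_point f x \<longleftrightarrow> (\<forall>\<^sub>F z in nhds x. f x \<le> f z)"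

definition local_extremal_point :: "('a::topological_space \<Rightarrow> real) \<Rightarrow> 'a \<Rightarrow> bool" where
  "local_extremal_point f x \<longleftrightarrow> local_max_point f x \<or> local_min_point f x"

end

theory Submission
  imports Defs
begin

text \<open>
  By the identity
  \<open>\<nabla> \<times> (J \<times> H) = (\<nabla> \<cdot> H) J - (\<nabla> \<cdot> J) H + (H \<cdot> \<nabla>) J - (J \<cdot> \<nabla>) H\<close>
  (\<open>curl_cross3\<close>) and \<open>\<nabla> \<cdot> H = 0\<close>, the equation is a damped transport equation with velocity
  \<open>v = y / (\<alpha> + 2) - J\<close>,
  \<open>\<partial>\<^sub>s H + (v \<cdot> \<nabla>) H + \<alpha> / (\<alpha> + 2) H = (\<nabla> \<cdot> J) H - (H \<cdot> \<nabla>) J\<close>.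
  Suppose that \<open>\<nabla> J\<close> is small on a ball around the origin at all times. Because \<open>J\<close> vanishes at
  the origin, \<open>J\<close> is then dominated by \<open>y / (\<alpha> + 2)\<close>, so \<open>v\<close> nowhere points towards the
  origin, while the right-hand side is weaker than the damping. By periodicity \<open>|H|\<close> attains its
  maximum over the ball and all times. At such a point the time derivative of \<open>|H|\<^sup>2\<close> is zero and,
  since moving along \<open>-v\<close> stays in the ball, its derivative along \<open>v\<close> is nonnegative. The damping
  thus forces the maximum to be zero, and \<open>H\<close> vanishes on the ball
  (\<open>solution_eq_0_on_ball_if_grad_small\<close>).

  It remains to see that \<open>\<nabla> J\<close> is small everywhere. It is zero at the origin, where the components of
  \<open>J\<close> have local extrema. If it failed to be small somewhere, there would be a point of failure
  \<open>(y, s)\<close> with \<open>|y|\<close> minimal, and \<open>y \<noteq> 0\<close>. On every smaller ball \<open>\<nabla> J\<close> is small, so \<open>H\<close>, hence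
  \<open>J\<close> and \<open>\<nabla> J\<close>, vanish on the open ball of radius \<open>|y|\<close>; by continuity \<open>\<nabla> J\<close> vanishes at
  \<open>(y, s)\<close> as well, a contradiction.
\<close>

section \<open>Calculus of the partial derivatives\<close>

lemma has_derivative_advect:
  assumes "f differentiable (at y)"
  shows "(f has_derivative (\<lambda>v. advect v f y)) (at y)"
proof -
  let ?D = "frechet_derivative f (at y)"
  have D: "(f has_derivative ?D) (at y)"
    using assms frechet_derivative_works by blast
  then have lin: "linear ?D"
    by (rule has_derivative_linear)
  have "?D v = advect v f y" for v
  proof -
    have "?D v = ?D (\<Sum>i\<in>UNIV. v $ i *\<^sub>R axis i 1)"
      by (simp add: basis_expansion flip: scalar_mult_eq_scaleR)
    also have "\<dots> = advect v f y"
      by (simp add: linear_sum[OF lin] linear_scale[OF lin] advect_def pderiv_y_def)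
    finally show ?thesis .
  qed
  with D show ?thesis
    by (metis (no_types, lifting) ext)
qed

lemma pderiv_y_eq:
  assumes "(f has_derivative D) (at y)"
  shows "pderiv_y i f y = D (axis i 1)"
  using frechet_derivative_at[OF assms] by (simp add: pderiv_y_def)

lemma pderiv_y_eq_0_on_open:
  assumes "open U" "y \<in> U" "\<And>z. z \<in> U \<Longrightarrow> f z = 0"
  shows "pderiv_y i f y = 0"
proof -
  have "(f has_derivative (\<lambda>_. 0)) (at y)"
    by (rule has_derivative_transform_within_open[of "\<lambda>_. 0"]) (use assms in auto)
  then show ?thesis
    by (simp add: pderiv_y_eq)
qed

lemma norm_advect_le:
  assumes "\<And>i. norm (pderiv_y i f y) \<le> k"
  shows "norm (advect v f y) \<le> 3 * k * norm v"
proof -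
  have "norm (advect v f y) \<le> (\<Sum>i\<in>(UNIV::3 set). norm v * k)"
    unfolding advect_def
    by (rule sum_norm_le) (auto intro!: mult_mono assms component_le_norm_cart)
  then show ?thesis
    by (simp add: mult_ac)
qed

lemma abs_divergence_le:
  assumes "\<And>i. norm (pderiv_y i F y) \<le> k"
  shows "\<bar>divergence F y\<bar> \<le> 3 * k"
proof -
  have "\<bar>divergence F y\<bar> \<le> (\<Sum>i\<in>(UNIV::3 set). k)"
    unfolding divergence_def real_norm_def[symmetric]
    by (rule sum_norm_le) (metis assms component_le_norm_cart order_trans real_norm_def)
  then show ?thesis
    by simp
qed

text \<open>
  In this form the curl is a sum of constant linear maps applied to the partial derivatives, so that
  it inherits regularity term by term.
\<close>

lemma curl_eq_sum_cross3: "curl F y = (\<Sum>i\<in>UNIV. cross3 (axis i 1) (pderiv_y i F y))"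
  by (simp add: curl_def sum_3 vec_eq_iff forall_3 cross3_def axis_def)

lemma curl_cross3:
  assumes F: "F differentiable (at y)" and G: "G differentiable (at y)"
  shows "curl (\<lambda>z. cross3 (F z) (G z)) y =
    divergence G y *\<^sub>R F y - divergence F y *\<^sub>R G y + advect (G y) F y - advect (F y) G y"
proof -
  interpret bounded_bilinear cross3
    using bilinear_cross bilinear_conv_bounded_bilinear by blast
  have product_rule: "pderiv_y i (\<lambda>z. cross3 (F z) (G z)) y
      = cross3 (F y) (pderiv_y i G y) + cross3 (pderiv_y i F y) (G y)" for i
    using pderiv_y_eq[OF FDERIV[OF has_derivative_advect[OF F] has_derivative_advect[OF G]], of i]
    by (simp add: pderiv_y_eq[OF has_derivative_advect[OF F]] pderiv_y_eq[OF has_derivative_advect[OF G]])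
  show ?thesis
    unfolding curl_def product_rule
    by (simp add: divergence_def advect_def vec_eq_iff forall_3 sum_3 cross3_def algebra_simps)
qed

lemma Ck_y_imp_continuous: "Ck_y k f \<Longrightarrow> continuous_on UNIV (\<lambda>(y, s). f y s)"
  by (cases k) auto

lemma Ck_y_add:
  assumes "Ck_y k f" "Ck_y k g"
  shows "Ck_y k (\<lambda>y s. f y s + g y s)"
  using assms
proof (induction k arbitrary: f g)
  case 0
  then show ?case
    by (auto simp: case_prod_unfold intro!: continuous_intros)
next
  case (Suc k)
  then have "pderiv_y i (\<lambda>z. f z s + g z s) y = pderiv_y i (\<lambda>z. f z s) y + pderiv_y i (\<lambda>z. g z s) y"
    for i y s
    by (subst pderiv_y_eq[OF has_derivative_add[OF has_derivative_advect has_derivative_advect]])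
       (auto simp: pderiv_y_eq[OF has_derivative_advect])
  with Suc show ?case
    by (auto simp: case_prod_unfold intro!: continuous_intros)
qed

lemma Ck_y_bounded_linear:
  assumes L: "bounded_linear L" and "Ck_y k f"
  shows "Ck_y k (\<lambda>y s. L (f y s))"
  using assms(2)
proof (induction k arbitrary: f)
  case 0
  then show ?case
    by (auto simp: case_prod_unfold intro!: bounded_linear.continuous_on[OF L])
next
  case (Suc k)
  have D: "((\<lambda>z. L (f z s)) has_derivative (\<lambda>v. L (advect v (\<lambda>z. f z s) y))) (at y)" for y s
    using Suc.prems by (intro bounded_linear.has_derivative[OF L] has_derivative_advect) auto
  have "pderiv_y i (\<lambda>z. L (f z s)) y = L (pderiv_y i (\<lambda>z. f z s) y)" for i y s
    using Suc.prems by (subst pderiv_y_eq[OF D]) (auto simp: pderiv_y_eq[OF has_derivative_advect])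
  with Suc D show ?case
    by (auto simp: case_prod_unfold differentiable_def intro!: bounded_linear.continuous_on[OF L])
qed

lemma Ck_y_curl:
  assumes "Ck_y (Suc k) F"
  shows "Ck_y k (\<lambda>y s. curl (\<lambda>z. F z s) y)"
proof -
  have "bounded_linear (cross3 a)" for a
    using bilinear_cross by (auto simp: bilinear_def linear_conv_bounded_linear)
  with assms show ?thesis
    unfolding curl_eq_sum_cross3 sum_3
    by (intro Ck_y_add Ck_y_bounded_linear[where L = "cross3 _"]) auto
qed

section \<open>First-order conditions\<close>

text \<open>
  A one-sided condition: only the segment from \<open>y\<close> in direction \<open>-v\<close> competes, so the lemma applies
  at the boundary of a ball when \<open>v\<close> points outwards. The inner product is half the derivative of
  \<open>|f|\<^sup>2\<close> along \<open>v\<close>.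
\<close>

lemma inner_advect_nonneg_at_norm_max:
  fixes f :: "real^3 \<Rightarrow> 'b::real_inner"
  assumes f: "f differentiable (at y)"
    and max: "\<And>t. 0 \<le> t \<Longrightarrow> t \<le> 1 \<Longrightarrow> norm (f (y - t *\<^sub>R v)) \<le> norm (f y)"
  shows "0 \<le> f y \<bullet> advect v f y"
proof (rule ccontr)
  assume neg: "\<not> ?thesis"
  let ?g = "\<lambda>t. f (y - t *\<^sub>R v) \<bullet> f (y - t *\<^sub>R v)"
  have lin: "advect (- (t *\<^sub>R v)) f y = - (t *\<^sub>R advect v f y)" for t
    by (simp add: advect_def sum_negf scaleR_sum_right)
  have "(f has_derivative (\<lambda>v. advect v f y)) (at (y - 0 *\<^sub>R v))"
    using has_derivative_advect[OF f] by simp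
  then have "((\<lambda>t. f (y - t *\<^sub>R v)) has_derivative (\<lambda>t. - (t *\<^sub>R advect v f y))) (at 0)"
    unfolding lin[symmetric]
    by (rule has_derivative_compose[where g = f, rotated]) (auto intro!: derivative_eq_intros)
  from has_derivative_inner[OF this this]
  have "(?g has_real_derivative - 2 * (f y \<bullet> advect v f y)) (at 0)"
    unfolding has_field_derivative_def
    by (rule has_derivative_eq_rhs) (auto simp: inner_commute algebra_simps)
  from DERIV_pos_inc_right[OF this] neg obtain d
    where d: "d > 0" "\<And>h. h > 0 \<Longrightarrow> h < d \<Longrightarrow> ?g 0 < ?g (0 + h)"
    by auto
  define h where "h = min 1 (d / 2)"
  have "?g 0 < ?g h"
    using d(1) d(2)[of h] by (simp add: h_def)
  moreover have "norm (f (y - h *\<^sub>R v)) \<le> norm (f y)"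
    using d(1) by (intro max) (auto simp: h_def)
  ultimately show False
    by (simp add: norm_le)
qed

lemma inner_vector_derivative_eq_0_at_norm_max:
  fixes g :: "real \<Rightarrow> 'b::real_inner"
  assumes g: "g differentiable (at s)" and max: "\<And>t. norm (g t) \<le> norm (g s)"
  shows "g s \<bullet> vector_derivative g (at s) = 0"
proof -
  have "(g has_derivative (\<lambda>h. h *\<^sub>R vector_derivative g (at s))) (at s)"
    using g vector_derivative_works has_vector_derivative_def by blast
  from has_derivative_inner[OF this this] 
  have "(\<lambda>h. g s \<bullet> (h *\<^sub>R vector_derivative g (at s))
      + (h *\<^sub>R vector_derivative g (at s)) \<bullet> g s) = (\<lambda>_. 0)"
    by (rule differential_zero_maxmin[where S = UNIV, rotated 2]) (use max in \<open>auto simp: norm_le\<close>)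
  from fun_cong[OF this, of 1] show ?thesis
    by (simp add: inner_commute)
qed

lemma pderiv_y_eq_0_at_local_extremum:
  fixes f :: "real^3 \<Rightarrow> real^'n"
  assumes f: "f differentiable (at y)" and ext: "\<And>j. local_extremal_point (\<lambda>z. f z $ j) y"
  shows "pderiv_y i f y = 0"
proof -
  have "pderiv_y i f y $ j = 0" for j
  proof -
    have D: "((\<lambda>z. f z $ j) has_derivative (\<lambda>v. advect v f y $ j)) (at y)"
      by (rule bounded_linear.has_derivative[OF bounded_linear_vec_nth has_derivative_advect[OF f]])
    have "(\<lambda>v. advect v f y $ j) = (\<lambda>_. 0)"
      using ext[of j] has_derivative_local_min[OF D] has_derivative_local_max[OF D]
      unfolding local_extremal_point_def local_max_point_def local_min_point_def
      by (auto dest: filter_leD[OF at_le[of _ UNIV], rotated] simp: eventually_nhds_conv_at)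
    from fun_cong[OF this, of "axis i 1"] show ?thesis
      by (simp add: pderiv_y_eq[OF has_derivative_advect[OF f]])
  qed
  then show ?thesis
    by (simp add: vec_eq_iff)
qed

section \<open>Vanishing where the current has small gradient\<close>

lemma ex_periodic_representative:
  fixes f :: "real \<Rightarrow> 'a"
  assumes "p > 0" and per: "\<And>s. f (s + p) = f s"
  shows "\<exists>t\<in>{0..p}. f t = f s"
proof -
  have nat: "f (s + real n * p) = f s" for n s
  proof (induction n)
    case (Suc n)
    then show ?case
      using per[of "s + real n * p"] by (simp add: algebra_simps)
  qed simp
  have int: "f (s + of_int k * p) = f s" for k s
  proof (cases k)
    case (neg n)
    have shift: "s + of_int k * p + real (Suc n) * p = s"
      unfolding neg by (simp add: algebra_simps)
    show ?thesis
      using nat[of "s + of_int k * p" "Suc n"] unfolding shift by (rule sym)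
  qed (use nat in simp)
  show ?thesis
  proof
    let ?k = "- \<lfloor>s / p\<rfloor>"
    show "f (s + of_int ?k * p) = f s"
      by (rule int)
    have "of_int \<lfloor>s / p\<rfloor> * p \<le> s" "s \<le> (of_int \<lfloor>s / p\<rfloor> + 1) * p"
      using \<open>p > 0\<close> floor_divide_lower[of p s] floor_divide_upper[of p s] by auto
    then show "s + of_int ?k * p \<in> {0..p}"
      by (simp add: algebra_simps)
  qed
qed

text \<open>
  The maximum principle for the damped transport equation. With \<open>k\<close> bounding each of the three partial
  derivatives of \<open>J\<close>, the bound \<open>3 * k \<le> a\<close> keeps \<open>a y - J\<close> from pointing inwards, and \<open>6 * k < b\<close> makes the
  damping stronger than \<open>(H \<cdot> \<nabla>) J\<close> and \<open>(\<nabla> \<cdot> J) H\<close>, each of which costs \<open>3 * k\<close>.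
\<close>

lemma solution_eq_0_on_ball_if_grad_small:
  fixes a b S0 k R :: real and H J :: "real^3 \<Rightarrow> real \<Rightarrow> real^3"
  assumes "0 < S0" and "a \<le> 1" and "0 \<le> R"
    and k: "0 \<le> k" "3 * k \<le> a" "6 * k < b"
    and H_y: "\<And>y s. (\<lambda>z. H z s) differentiable (at y)"
    and H_s: "\<And>y s. (\<lambda>t. H y t) differentiable (at s)"
    and H_cont: "continuous_on UNIV (\<lambda>(y, s). H y s)"
    and J_y: "\<And>y s. (\<lambda>z. J z s) differentiable (at y)"
    and J_0: "\<And>s. J 0 s = 0"
    and periodic: "\<And>s. (\<lambda>y. H y (s + S0)) = (\<lambda>y. H y s)"
    and eq: "\<And>y s. pderiv_s H y s + b *\<^sub>R H y s + a *\<^sub>R advect y (\<lambda>z. H z s) y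
              + curl (\<lambda>z. cross3 (J z s) (H z s)) y = 0"
    and div_free: "\<And>y s. divergence (\<lambda>z. H z s) y = 0"
    and small: "\<And>i y s. norm y \<le> R \<Longrightarrow> norm (pderiv_y i (\<lambda>z. J z s) y) \<le> k"
    and "norm y \<le> R"
  shows "H y s = 0"
proof -
  have compact: "compact (cball (0::real^3) R \<times> {0..S0})"
    by (intro compact_Times) auto
  have cont: "continuous_on (cball 0 R \<times> {0..S0}) (\<lambda>(y, s). norm (H y s))"
    using continuous_on_subset[OF H_cont subset_UNIV]
    by (auto simp: case_prod_unfold intro!: continuous_intros)
  have "cball (0::real^3) R \<times> {0..S0} \<noteq> {}"
    using \<open>0 < S0\<close> \<open>0 \<le> R\<close> by auto
  from continuous_attains_sup[OF compact this cont] obtain y0 s0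
    where y0: "norm y0 \<le> R"
      and max': "\<And>y s. norm y \<le> R \<Longrightarrow> s \<in> {0..S0} \<Longrightarrow> norm (H y s) \<le> norm (H y0 s0)"
    by fastforce
  have max: "norm (H y s) \<le> norm (H y0 s0)" if "norm y \<le> R" for y s
  proof -
    obtain t where "t \<in> {0..S0}" "(\<lambda>y. H y t) = (\<lambda>y. H y s)"
      using ex_periodic_representative[of S0 "\<lambda>s y. H y s" s] \<open>0 < S0\<close> periodic by auto
    with max'[OF that] show ?thesis
      by metis
  qed

  define h where "h = H y0 s0"
  define v where "v = a *\<^sub>R y0 - J y0 s0"
  have J_le: "norm (J y0 s0) \<le> a * norm y0"
  proof -
    have "norm (J y0 s0 - J 0 s0) \<le> (3 * k) * norm (y0 - 0)"
    proof (rule differentiable_bound[of "cball 0 R" "\<lambda>z. J z s0" "\<lambda>x v. advect v (\<lambda>z. J z s0) x"])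
      show "((\<lambda>z. J z s0) has_derivative (\<lambda>v. advect v (\<lambda>z. J z s0) x)) (at x within cball 0 R)" for x
        using has_derivative_advect[OF J_y] has_derivative_at_withinI by blast
      show "onorm (\<lambda>v. advect v (\<lambda>z. J z s0) x) \<le> 3 * k" if "x \<in> cball 0 R" for x
        using that by (intro onorm_bound norm_advect_le small) (use k in auto)
    qed (use y0 \<open>0 \<le> R\<close> in auto)
    also have "\<dots> \<le> a * norm y0"
      using k by (auto intro: mult_right_mono)
    finally show ?thesis
      by (simp add: J_0)
  qed
  \<comment> \<open>The backward point \<open>y0 - t v\<close> is \<open>(1 - t a) y0 + t J\<close>, which is no farther from the origin than
    \<open>y0\<close>: for interior and boundary maxima alike it stays in the ball.\<close>
  have "0 \<le> h \<bullet> advect v (\<lambda>z. H z s0) y0"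
    unfolding h_def
  proof (rule inner_advect_nonneg_at_norm_max)
    fix t :: real
    assume t: "0 \<le> t" "t \<le> 1"
    have "t * a \<le> 1"
      using mult_mono[of t 1 a 1] t \<open>a \<le> 1\<close> k by simp
    have "y0 - t *\<^sub>R v = (1 - t * a) *\<^sub>R y0 + t *\<^sub>R J y0 s0"
      by (simp add: v_def algebra_simps)
    also have "norm \<dots> \<le> (1 - t * a) * norm y0 + t * (a * norm y0)"
      using t \<open>t * a \<le> 1\<close>
      by (intro order.trans[OF norm_triangle_ineq] add_mono) (auto intro: mult_left_mono J_le)
    also have "\<dots> = norm y0"
      by (simp add: algebra_simps)
    finally show "norm (H (y0 - t *\<^sub>R v) s0) \<le> norm (H y0 s0)"
      using y0 by (intro max) auto
  qed (rule H_y)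
  moreover have "h \<bullet> pderiv_s H y0 s0 = 0"
    unfolding h_def pderiv_s_def
    by (rule inner_vector_derivative_eq_0_at_norm_max) (use H_s max y0 in auto)
  moreover have "pderiv_s H y0 s0 + b *\<^sub>R h + advect v (\<lambda>z. H z s0) y0
      + advect h (\<lambda>z. J z s0) y0 - divergence (\<lambda>z. J z s0) y0 *\<^sub>R h = 0"
    (is "?lhs = 0")
  proof -
    have advect_v: "advect v (\<lambda>z. H z s0) y0
        = a *\<^sub>R advect y0 (\<lambda>z. H z s0) y0 - advect (J y0 s0) (\<lambda>z. H z s0) y0"
      by (simp add: v_def advect_def scaleR_sum_right sum_subtractf scaleR_left_diff_distrib)
    have "?lhs = pderiv_s H y0 s0 + b *\<^sub>R H y0 s0 + a *\<^sub>R advect y0 (\<lambda>z. H z s0) y0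
        + curl (\<lambda>z. cross3 (J z s0) (H z s0)) y0"
      unfolding advect_v curl_cross3[OF J_y H_y] div_free h_def by simp
    also have "\<dots> = 0"
      by (rule eq)
    finally show ?thesis .
  qed
  from arg_cong[OF this, of "\<lambda>x. h \<bullet> x"]
  have "h \<bullet> pderiv_s H y0 s0 + b * (norm h)\<^sup>2 + h \<bullet> advect v (\<lambda>z. H z s0) y0
      + h \<bullet> advect h (\<lambda>z. J z s0) y0 - divergence (\<lambda>z. J z s0) y0 * (norm h)\<^sup>2 = 0"
    by (simp add: inner_right_distrib inner_diff_right power2_norm_eq_inner)
  moreover have "- (h \<bullet> advect h (\<lambda>z. J z s0) y0) \<le> (3 * k) * (norm h)\<^sup>2"
  proof -
    have "\<bar>h \<bullet> advect h (\<lambda>z. J z s0) y0\<bar> \<le> norm h * (3 * k * norm h)"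
      by (intro order.trans[OF Cauchy_Schwarz_ineq2] mult_left_mono norm_advect_le small y0) auto
    then show ?thesis
      by (simp add: power2_eq_square algebra_simps)
  qed
  moreover have "divergence (\<lambda>z. J z s0) y0 * (norm h)\<^sup>2 \<le> (3 * k) * (norm h)\<^sup>2"
    by (rule mult_right_mono[OF order.trans[OF abs_ge_self abs_divergence_le[OF small[OF y0]]]]) simp
  ultimately have "(b - 6 * k) * (norm h)\<^sup>2 \<le> 0"
    by (simp add: algebra_simps)
  then have "h = 0"
    using k(3) by (simp add: mult_le_0_iff)
  then show ?thesis
    using max[OF \<open>norm y \<le> R\<close>, of s] by (simp add: h_def)
qed

section \<open>Spreading from the origin\<close>

theorem theorem1p5:
  fixes \<alpha> S0 :: real
    and H J :: "real^3 \<Rightarrow> real \<Rightarrow> real^3"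
  assumes "\<alpha> > 0" and "S0 > 0"
    and "Ck_y_C1_s 3 H"
    and periodic: "\<And>y s. H y (s + S0) = H y s"
    and J_def: "\<And>y s. J y s = curl (\<lambda>z. H z s) y"
    and eq: "\<And>y s. pderiv_s H y s + (\<alpha> / (\<alpha> + 2)) *\<^sub>R H y s
              + (1 / (\<alpha> + 2)) *\<^sub>R advect y (\<lambda>z. H z s) y
              + curl (\<lambda>z. cross3 (curl (\<lambda>w. H w s) z) (H z s)) y = 0"
    and div_free: "\<And>y s. divergence (\<lambda>z. H z s) y = 0"
    and extremal: "\<And>s i. 0 < s \<Longrightarrow> s < S0 \<Longrightarrow> local_extremal_point (\<lambda>y. J y s $ i) 0"
    and J_zero: "\<And>s. 0 < s \<Longrightarrow> s < S0 \<Longrightarrow> J 0 s = 0"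
  shows "\<forall>y s. H y s = 0"
proof -
  have J_curl: "J = (\<lambda>y s. curl (\<lambda>z. H z s) y)"
    by (intro ext J_def)
  have CH: "Ck_y (Suc 2) H" "C1_s H"
    using \<open>Ck_y_C1_s 3 H\<close> by (auto simp: Ck_y_C1_s_def eval_nat_numeral)
  have H_y: "(\<lambda>z. H z s) differentiable (at y)" for y s
    using CH(1) unfolding Ck_y.simps by blast
  have H_s: "(\<lambda>t. H y t) differentiable (at s)" for y s
    using CH(2) by (simp add: C1_s_def)
  have H_cont: "continuous_on UNIV (\<lambda>(y, s). H y s)"
    using CH(2) by (simp add: C1_s_def)
  have periodic': "(\<lambda>y. H y (s + S0)) = (\<lambda>y. H y s)" for s
    by (simp add: periodic)
  have CJ: "Ck_y (Suc 1) J"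
    using Ck_y_curl[OF CH(1)] by (simp add: J_curl eval_nat_numeral)
  define G where "G i y s = pderiv_y i (\<lambda>z. J z s) y" for i y s
  have J_y: "(\<lambda>z. J z s) differentiable (at y)" for y s
    using CJ by simp
  have J_cont: "continuous_on UNIV (\<lambda>(y, s). J y s)"
    using CJ by simp
  have G_cont: "continuous_on UNIV (\<lambda>(y, s). G i y s)" for i
    using CJ by (simp add: G_def)

  have repr: "\<exists>t\<in>{0..S0}. (\<lambda>y. J y t) = (\<lambda>y. J y s)" for s
    by (rule ex_periodic_representative) (use \<open>S0 > 0\<close> periodic' in \<open>auto simp: J_curl\<close>)

  \<comment> \<open>The conditions at the origin are given on the open interval only; continuity in time
    carries them to its endpoints.\<close>
  have vanish_on_closed_period: "f s = 0"
    if "continuous_on UNIV f" "\<And>s. 0 < s \<Longrightarrow> s < S0 \<Longrightarrow> f s = 0" "s \<in> {0..S0}"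
    for f :: "real \<Rightarrow> real^3" and s
    by (rule continuous_constant_on_closure[of "{0<..<S0}"])
       (use that \<open>S0 > 0\<close> in \<open>auto intro: continuous_on_subset\<close>)
  have slice: "continuous_on UNIV (\<lambda>s. f y s)" if "continuous_on UNIV (\<lambda>(y, s). f y s)"
    for f :: "real^3 \<Rightarrow> real \<Rightarrow> real^3" and y
    using continuous_on_compose2[OF that continuous_on_Pair[OF continuous_on_const continuous_on_id]] by auto
  have J_0: "J 0 s = 0" for s
  proof -
    have "J 0 t = 0" if "t \<in> {0..S0}" for t
      by (rule vanish_on_closed_period[OF slice[OF J_cont] J_zero that])
    then show ?thesis
      using repr[of s] by metis
  qed
  have G_0: "G i 0 s = 0" if "s \<in> {0..S0}" for i s
  proof (rule vanish_on_closed_period[OF slice[OF G_cont] _ that])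
    show "G i 0 t = 0" if "0 < t" "t < S0" for t
      unfolding G_def by (rule pderiv_y_eq_0_at_local_extremum[OF J_y extremal[OF that]])
  qed

  define a where "a = 1 / (\<alpha> + 2)"
  define b where "b = \<alpha> / (\<alpha> + 2)"
  \<comment> \<open>Any divisor above 6 satisfies both smallness conditions.\<close>
  define k where "k = min a b / 7"
  have ab: "0 < a" "a \<le> 1" "0 < b"
    using \<open>\<alpha> > 0\<close> by (auto simp: a_def b_def)
  then have k: "0 < k" "3 * k \<le> a" "6 * k < b"
    by (auto simp: k_def min_def)
  have eq': "pderiv_s H y s + b *\<^sub>R H y s + a *\<^sub>R advect y (\<lambda>z. H z s) y
              + curl (\<lambda>z. cross3 (J z s) (H z s)) y = 0" for y s
    using eq[of y s] by (simp add: a_def b_def J_def)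
  have H_0: "H y s = 0"
    if small: "\<And>i y s. norm y \<le> R \<Longrightarrow> s \<in> {0..S0} \<Longrightarrow> norm (G i y s) \<le> k"
      and "norm y \<le> R" for R y s
  proof (rule solution_eq_0_on_ball_if_grad_small[where a = a and b = b and R = R and k = k and J = J and y = y])
    show "norm (pderiv_y i (\<lambda>z. J z s) y) \<le> k" if y: "norm y \<le> R" for i y s
    proof -
      obtain t where "t \<in> {0..S0}" "(\<lambda>y. J y t) = (\<lambda>y. J y s)"
        using repr by blast
      then show ?thesis
        using small[OF y, of t i] by (simp add: G_def)
    qed
    show "0 \<le> R"
      using \<open>norm y \<le> R\<close> norm_ge_zero order_trans by blast
  qed (fact ab k less_imp_le[OF k(1)] \<open>S0 > 0\<close> H_y H_s H_cont J_y J_0 periodic' eq' div_free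
      \<open>norm y \<le> R\<close>)+

  \<comment> \<open>The points where the gradient of \<open>J\<close> is not small; one of minimal \<open>norm y\<close> would lie
    on the boundary of an open ball on which \<open>H\<close> vanishes at all times.\<close>
  define K where "K = {(y, s). s \<in> {0..S0} \<and> (\<exists>i. k \<le> norm (G i y s))}"
  have not_K: "norm (G i y s) \<le> k" if "(y, s) \<notin> K" "s \<in> {0..S0}" for i y s
  proof -
    have "\<not> k \<le> norm (G i y s)"
      using that by (simp add: K_def)
    then show ?thesis
      by simp
  qed
  have "K = {}"
  proof (rule ccontr)
    assume "K \<noteq> {}"
    then obtain y1 s1 where y1: "(y1, s1) \<in> K"
      by auto
    have K_eq: "K = (UNIV \<times> {0..S0}) \<inter> (\<Union>i. {p. k \<le> norm (case p of (y, s) \<Rightarrow> G i y s)})"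
      by (auto simp: K_def)
    have "closed {p. k \<le> norm (case p of (y, s) \<Rightarrow> G i y s)}" for i
      by (rule closed_Collect_le[OF continuous_on_const continuous_on_norm[OF G_cont]])
    then have "closed K"
      unfolding K_eq
      by (intro closed_Int closed_Times closed_UNIV closed_atLeastAtMost closed_UN finite ballI)
    define C where "C = K \<inter> (cball 0 (norm y1) \<times> {0..S0})"
    have "compact C"
      unfolding C_def by (rule closed_Int_compact[OF \<open>closed K\<close> compact_Times]) auto
    moreover have "(y1, s1) \<in> C"
      using y1 by (auto simp: C_def K_def)
    then have "C \<noteq> {}"
      by blast
    moreover have "continuous_on C (\<lambda>p. norm (fst p))"
      by (intro continuous_intros)
    ultimately obtain p where p: "p \<in> C" "\<forall>q\<in>C. norm (fst p) \<le> norm (fst q)"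
      using continuous_attains_inf by blast
    obtain y2 s2 where p_eq: "p = (y2, s2)"
      by (cases p)
    have y2: "(y2, s2) \<in> K" "norm y2 \<le> norm y1"
      using p(1) by (auto simp: C_def p_eq)
    have min': "norm y2 \<le> norm y" if "(y, s) \<in> K" "norm y \<le> norm y1" for y s
    proof -
      have "(y, s) \<in> C"
        using that by (auto simp: C_def K_def)
      with p(2) show ?thesis
        by (fastforce simp: p_eq)
    qed
    have min: "norm y2 \<le> norm y" if "(y, s) \<in> K" for y s
      using min'[OF that] y2(2) by linarith
    from y2(1) obtain i where s2: "s2 \<in> {0..S0}" and i: "k \<le> norm (G i y2 s2)"
      by (auto simp: K_def)
    have "y2 \<noteq> 0"
      using i G_0[OF s2] k(1) by auto
    have H_ball: "H y s = 0" if "y \<in> ball 0 (norm y2)" for y s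
    proof (rule H_0)
      show "norm (G i z t) \<le> k" if "norm z \<le> norm y" "t \<in> {0..S0}" for i z t
      proof -
        have "(z, t) \<notin> K"
          using min[of z t] \<open>y \<in> ball 0 (norm y2)\<close> that(1) by auto
        then show ?thesis
          using that(2) by (rule not_K)
      qed
    qed simp
    have J_ball: "J y s = 0" if "y \<in> ball 0 (norm y2)" for y s
    proof -
      have "pderiv_y j (\<lambda>z. H z s) y = 0" for j
        by (rule pderiv_y_eq_0_on_open[OF open_ball that H_ball])
      then show ?thesis
        by (simp add: J_def curl_eq_sum_cross3)
    qed
    have G_ball: "G i y s2 = 0" if "y \<in> ball 0 (norm y2)" for y
      unfolding G_def by (rule pderiv_y_eq_0_on_open[OF open_ball that J_ball])
    have "continuous_on UNIV (\<lambda>y. G i y s2)"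
      using continuous_on_compose2[OF G_cont continuous_on_Pair[OF continuous_on_id continuous_on_const]]
      by auto
    then have "continuous_on (closure (ball 0 (norm y2))) (\<lambda>y. G i y s2)"
      by (rule continuous_on_subset) simp
    then have "G i y2 s2 = 0"
      by (rule continuous_constant_on_closure[OF _ G_ball]) (use \<open>y2 \<noteq> 0\<close> in simp_all)
    with i k(1) show False
      by simp
  qed
  show ?thesis
  proof (intro allI)
    show "H y s = 0" for y s
    proof (rule H_0[where R = "norm y"])
      show "norm (G i z t) \<le> k" if "t \<in> {0..S0}" for i z t
        by (rule not_K[OF _ that]) (simp add: \<open>K = {}\<close>)
    qed simp
  qed
qed

end
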